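(* Let $\Gamma$ be a basis, $M$ a $CL$-term and $\sigma$ a simple type. If $\Gamma\vdash_{CL^=}M:\sigma$, then $\Gamma\models M:\sigma$.
   Context: $CL$-terms: $M,N ::= x \mid \mathsf{S} \mid \mathsf{K} \mid \mathsf{I} \mid MN$ over a countable set $V$ of term variables. The equational theory $\mathcal{EQ}^\eta$ has axioms $M=M$, $\mathsf S MNL=(ML)(NL)$, $\mathsf K MN=M$, $\mathsf I M=M$ and rules: symmetry, transitivity, from $M=N$ infer $MP=NP$ and $PM=PN$, and from $Mx=Nx$ with $x$ not occurring in $M$ or $N$ infer $M=N$. Simple types $\sigma ::= a\mid\sigma\to\tau$ (set ${\sf Types}$). A basis is a set of declarations $x:\sigma$ with pairwise distinct variables. The system $CL_\rightarrow^=$ derives $\Gamma\vdash_{CL^=}M:\sigma$ by: $x:\sigma$ if $x:\sigma\in\Gamma$; $\mathsf S:(\sigma\to(\rho\to\tau))\to((\sigma\to\rho)\to(\sigma\to\tau))$; $\mathsf K:\sigma\to(\tau\to\sigma)$; $\mathsf I:\sigma\to\sigma$ (all types); from $M:\sigma\to\tau$ and $N:\sigma$ infer $MN:\tau$; and (eq): from $\Gamma\vdash_{CL^=}M:\sigma$ and $M=N$ provable in $\mathcal{EQ}^\eta$ infer $\Gamma\vdash_{CL^=}N:\sigma$. An applicative structure for $LCL$ is $\langle D,\{A^\sigma\}_{\sigma\in{\sf Types}},\cdot,\mathbf s,\mathbf k,\mathbf i\rangle$ with $D$ nonempty, $A^\sigma\subseteq D$, $\cdot:D\times D\to D$ extensional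 (if $d_1\cdot e=d_2\cdot e$ for all $e$ then $d_1=d_2$) and mapping $A^{\sigma\to\tau}\times A^\sigma$ into $A^\tau$; $\mathbf s\in A^{(\sigma\to(\tau\to\rho))\to((\sigma\to\tau)\to(\sigma\to\rho))}$ for all $\sigma,\tau,\rho$ with $((\mathbf s\cdot d)\cdot e)\cdot f=(d\cdot f)\cdot(e\cdot f)$; $\mathbf k\in A^{\sigma\to(\tau\to\sigma)}$ for all $\sigma,\tau$ with $(\mathbf k\cdot d)\cdot e=d$; $\mathbf i\in A^{\sigma\to\sigma}$ for all $\sigma$ with $\mathbf i\cdot d=d$. An $LCL$-model $\mathcal M_\rho$ is such a structure with an environment $\rho:V\to D$. Interpretation: $[\![x]\!]_\rho=\rho(x)$, $[\![\mathsf S]\!]_\rho=\mathbf s$, $[\![\mathsf K]\!]_\rho=\mathbf k$, $[\![\mathsf I]\!]_\rho=\mathbf i$, $[\![MN]\!]_\rho=[\![M]\!]_\rho\cdot[\![N]\!]_\rho$. $\mathcal M_\rho\models M:\sigma$ iff $[\![M]\!]_\rho\in A^\sigma$. $\Gamma\models M:\sigma$ means every $LCL$-model satisfying all declarations in $\Gamma$ satisfies $M:\sigma$. *)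

theory Defs
  imports Main "HOL-Library.Countable"
begin

datatype (vars: 'v) cl_term =
    Var 'v
  | S
  | K
  | I
  | App "'v cl_term" "'v cl_term"  (infixl \<open>\<^bold>\<cdot>\<close> 100)

datatype 'a simple_type =
    Atom 'a
  | Arrow "'a simple_type" "'a simple_type"  (infixr \<open>\<^bold>\<rightarrow>\<close> 60)

inductive eq_eta :: "'v cl_term \<Rightarrow> 'v cl_term \<Rightarrow> bool" where
  refl: "eq_eta M M"
| S: "eq_eta (S \<^bold>\<cdot> M \<^bold>\<cdot> N \<^bold>\<cdot> L) ((M \<^bold>\<cdot> L) \<^bold>\<cdot> (N \<^bold>\<cdot> L))"
| K: "eq_eta (K \<^bold>\<cdot> M \<^bold>\<cdot> N) M"
| I: "eq_eta (I \<^bold>\<cdot> M) M"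
| sym: "eq_eta M N \<Longrightarrow> eq_eta N M"
| trans: "eq_eta M N \<Longrightarrow> eq_eta N L \<Longrightarrow> eq_eta M L"
| app_left: "eq_eta M N \<Longrightarrow> eq_eta (M \<^bold>\<cdot> P) (N \<^bold>\<cdot> P)"
| app_right: "eq_eta M N \<Longrightarrow> eq_eta (P \<^bold>\<cdot> M) (P \<^bold>\<cdot> N)"
| ext: "eq_eta (M \<^bold>\<cdot> Var x) (N \<^bold>\<cdot> Var x) \<Longrightarrow> x \<notin> vars M \<Longrightarrow> x \<notin> vars N \<Longrightarrow> eq_eta M N"

text \<open>A basis may be infinite.\<close>

definition basis :: "('v \<times> 'a simple_type) set \<Rightarrow> bool" where
  "basis \<Gamma> \<longleftrightarrow> inj_on fst \<Gamma>"

inductive typing :: "('v \<times> 'a simple_type) set \<Rightarrow> 'v cl_term \<Rightarrow> 'a simple_type \<Rightarrow> bool"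
  for \<Gamma> where
  var: "(x, \<sigma>) \<in> \<Gamma> \<Longrightarrow> typing \<Gamma> (Var x) \<sigma>"
| S: "typing \<Gamma> S ((\<sigma> \<^bold>\<rightarrow> (\<rho> \<^bold>\<rightarrow> \<tau>)) \<^bold>\<rightarrow> ((\<sigma> \<^bold>\<rightarrow> \<rho>) \<^bold>\<rightarrow> (\<sigma> \<^bold>\<rightarrow> \<tau>)))"
| K: "typing \<Gamma> K (\<sigma> \<^bold>\<rightarrow> (\<tau> \<^bold>\<rightarrow> \<sigma>))"
| I: "typing \<Gamma> I (\<sigma> \<^bold>\<rightarrow> \<sigma>)"
| app: "typing \<Gamma> M (\<sigma> \<^bold>\<rightarrow> \<tau>) \<Longrightarrow> typing \<Gamma> N \<sigma> \<Longrightarrow> typing \<Gamma> (M \<^bold>\<cdot> N) \<tau>"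
| eq: "typing \<Gamma> M \<sigma> \<Longrightarrow> eq_eta M N \<Longrightarrow> typing \<Gamma> N \<sigma>"

record ('d, 'a) lcl_structure =
  dom :: "'d set"
  interp :: "'a simple_type \<Rightarrow> 'd set"
  appl :: "'d \<Rightarrow> 'd \<Rightarrow> 'd"
  comb_s :: 'd
  comb_k :: 'd
  comb_i :: 'd

definition applicative_structure :: "('d, 'a) lcl_structure \<Rightarrow> bool" where
  "applicative_structure \<M> \<longleftrightarrow>
     dom \<M> \<noteq> {} \<and>
     (\<forall>\<sigma>. interp \<M> \<sigma> \<subseteq> dom \<M>) \<and>
     (\<forall>d\<in>dom \<M>. \<forall>e\<in>dom \<M>. appl \<M> d e \<in> dom \<M>) \<and>
     (\<forall>d\<^sub>1\<in>dom \<M>. \<forall>d\<^sub>2\<in>dom \<M>.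
        (\<forall>e\<in>dom \<M>. appl \<M> d\<^sub>1 e = appl \<M> d\<^sub>2 e) \<longrightarrow> d\<^sub>1 = d\<^sub>2) \<and>
     (\<forall>\<sigma> \<tau>. \<forall>d\<in>interp \<M> (\<sigma> \<^bold>\<rightarrow> \<tau>). \<forall>e\<in>interp \<M> \<sigma>. appl \<M> d e \<in> interp \<M> \<tau>) \<and>
     (\<forall>\<sigma> \<tau> \<rho>. comb_s \<M> \<in>
        interp \<M> ((\<sigma> \<^bold>\<rightarrow> (\<tau> \<^bold>\<rightarrow> \<rho>)) \<^bold>\<rightarrow> ((\<sigma> \<^bold>\<rightarrow> \<tau>) \<^bold>\<rightarrow> (\<sigma> \<^bold>\<rightarrow> \<rho>)))) \<and>
     (\<forall>d\<in>dom \<M>. \<forall>e\<in>dom \<M>. \<forall>f\<in>dom \<M>.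
        appl \<M> (appl \<M> (appl \<M> (comb_s \<M>) d) e) f = appl \<M> (appl \<M> d f) (appl \<M> e f)) \<and>
     (\<forall>\<sigma> \<tau>. comb_k \<M> \<in> interp \<M> (\<sigma> \<^bold>\<rightarrow> (\<tau> \<^bold>\<rightarrow> \<sigma>))) \<and>
     (\<forall>d\<in>dom \<M>. \<forall>e\<in>dom \<M>. appl \<M> (appl \<M> (comb_k \<M>) d) e = d) \<and>
     (\<forall>\<sigma>. comb_i \<M> \<in> interp \<M> (\<sigma> \<^bold>\<rightarrow> \<sigma>)) \<and>
     (\<forall>d\<in>dom \<M>. appl \<M> (comb_i \<M>) d = d)"

definition lcl_model :: "('d, 'a) lcl_structure \<Rightarrow> ('v \<Rightarrow> 'd) \<Rightarrow> bool" where
  "lcl_model \<M> \<rho> \<longleftrightarrow> applicative_structure \<M> \<and> (\<forall>x. \<rho> x \<in> dom \<M>)"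

primrec eval_term :: "('d, 'a) lcl_structure \<Rightarrow> ('v \<Rightarrow> 'd) \<Rightarrow> 'v cl_term \<Rightarrow> 'd" where
  "eval_term \<M> \<rho> (Var x) = \<rho> x"
| "eval_term \<M> \<rho> S = comb_s \<M>"
| "eval_term \<M> \<rho> K = comb_k \<M>"
| "eval_term \<M> \<rho> I = comb_i \<M>"
| "eval_term \<M> \<rho> (M \<^bold>\<cdot> N) = appl \<M> (eval_term \<M> \<rho> M) (eval_term \<M> \<rho> N)"

definition satisfies ::
  "('d, 'a) lcl_structure \<Rightarrow> ('v \<Rightarrow> 'd) \<Rightarrow> 'v cl_term \<Rightarrow> 'a simple_type \<Rightarrow> bool" where
  "satisfies \<M> \<rho> M \<sigma> \<longleftrightarrow> eval_term \<M> \<rho> M \<in> interp \<M> \<sigma>"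

text \<open>HOL cannot quantify over types inside a definition, so the type from which the
  domains are drawn is a parameter. The semantic consequence relation over all models
  is obtained by leaving \<open>'d\<close> schematic in a theorem.\<close>

definition entails ::
  "'d itself \<Rightarrow> ('v \<times> 'a simple_type) set \<Rightarrow> 'v cl_term \<Rightarrow> 'a simple_type \<Rightarrow> bool" where
  "entails _ \<Gamma> M \<sigma> \<longleftrightarrow>
     (\<forall>(\<M> :: ('d, 'a) lcl_structure) \<rho>.
        lcl_model \<M> \<rho> \<and> (\<forall>(x, \<tau>)\<in>\<Gamma>. satisfies \<M> \<rho> (Var x) \<tau>) \<longrightarrow> satisfies \<M> \<rho> M \<sigma>)"

end

theory Submission
  imports Defs
begin

text \<open>Soundness by induction on the derivation (\<open>typing_sound\<close>). The sets
  \<open>interp\<close> of an applicative structure contain the combinators at all their types and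
  are closed under application, which settles every typing rule except the conversion rule. That
  rule needs convertible terms to have equal values in each model
  (\<open>eq_eta_sound\<close>).\<close>

lemma combs_in_dom:
  assumes "applicative_structure \<M>"
  shows "comb_s \<M> \<in> dom \<M>" "comb_k \<M> \<in> dom \<M>" "comb_i \<M> \<in> dom \<M>"
proof -
  have sub: "interp \<M> \<sigma> \<subseteq> dom \<M>" for \<sigma>
    using assms by (simp add: applicative_structure_def)
  show "comb_s \<M> \<in> dom \<M>"
    by (rule subsetD[OF sub]) (use assms in \<open>unfold applicative_structure_def, blast\<close>)
  show "comb_k \<M> \<in> dom \<M>"
    by (rule subsetD[OF sub]) (use assms in \<open>unfold applicative_structure_def, blast\<close>)
  show "comb_i \<M> \<in> dom \<M>"
    by (rule subsetD[OF sub]) (use assms in \<open>unfold applicative_structure_def, blast\<close>)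
qed

text \<open>The combinator laws and extensionality hold only on \<open>dom\<close>, so they apply to
  values of terms only once these are known to lie there.\<close>

lemma eval_term_in_dom:
  assumes "lcl_model \<M> \<rho>"
  shows "eval_term \<M> \<rho> M \<in> dom \<M>"
proof (induction M)
  case (Var x)
  then show ?case using assms by (simp add: lcl_model_def)
next
  case (App M N)
  then show ?case using assms by (simp add: lcl_model_def applicative_structure_def)
qed (use assms combs_in_dom in \<open>auto simp: lcl_model_def\<close>)

lemma eval_term_fun_upd:
  assumes "x \<notin> vars M"
  shows "eval_term \<M> (\<rho>(x := d)) M = eval_term \<M> \<rho> M"
  using assms by (induction M) auto

text \<open>The environment is generalized in the induction for the sake of \<open>ext\<close>: its
  premise is used with x sent to each element of the domain, which turns equality at a fresh
  variable into equality of functions.\<close>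

lemma eq_eta_sound:
  assumes "eq_eta M N" and "lcl_model \<M> \<rho>"
  shows "eval_term \<M> \<rho> M = eval_term \<M> \<rho> N"
  using assms
proof (induction arbitrary: \<rho> rule: eq_eta.induct)
  case (ext M x N)
  have "appl \<M> (eval_term \<M> \<rho> M) d = appl \<M> (eval_term \<M> \<rho> N) d" if "d \<in> dom \<M>" for d
  proof -
    have "lcl_model \<M> (\<rho>(x := d))"
      using ext.prems that by (simp add: lcl_model_def)
    from ext.IH[OF this] show ?thesis
      \<comment> \<open>Freshness of x removes the update from the values of both terms; what
        remains is the updated environment at x, which is d.\<close>
      using ext.hyps by (simp add: eval_term_fun_upd del: fun_upd_apply) simp
  qed
  moreover have "eval_term \<M> \<rho> M \<in> dom \<M>" "eval_term \<M> \<rho> N \<in> dom \<M>"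
    using ext.prems by (simp_all add: eval_term_in_dom)
  ultimately show ?case
    \<comment> \<open>Agreement on all arguments gives equality by extensionality.\<close>
    using ext.prems by (simp add: lcl_model_def applicative_structure_def)
next
  case (S M N L)
  then show ?case
    using eval_term_in_dom[OF S] by (simp add: lcl_model_def applicative_structure_def)
next
  case (K M N)
  then show ?case
    using eval_term_in_dom[OF K] by (simp add: lcl_model_def applicative_structure_def)
next
  case (I M)
  then show ?case
    using eval_term_in_dom[OF I] by (simp add: lcl_model_def applicative_structure_def)
qed simp_all

lemma typing_sound:
  assumes "typing \<Gamma> M \<sigma>" and "lcl_model \<M> \<rho>"
    and "\<forall>(x, \<tau>)\<in>\<Gamma>. satisfies \<M> \<rho> (Var x) \<tau>"
  shows "satisfies \<M> \<rho> M \<sigma>"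
  using assms(1)
proof (induction rule: typing.induct)
  case (var x \<sigma>)
  then show ?case using assms(3) by blast
next
  case (app M \<sigma> \<tau> N)
  then show ?case
    using assms(2) by (simp add: satisfies_def lcl_model_def applicative_structure_def)
next
  case (eq M \<sigma> N)
  then show ?case
    using eq_eta_sound[OF eq.hyps(2) assms(2)] by (simp add: satisfies_def)
qed (use assms(2) in \<open>simp_all add: satisfies_def lcl_model_def applicative_structure_def\<close>)

theorem mainTheorem15:
  fixes \<Gamma> :: "('v::countable \<times> 'a simple_type) set"
    and M :: "'v cl_term"
    and \<sigma> :: "'a simple_type"
  assumes "basis \<Gamma>"
    and "typing \<Gamma> M \<sigma>"
  shows "entails TYPE('d) \<Gamma> M \<sigma>"
  unfolding entails_def using typing_sound[OF assms(2)] by blast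

end
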